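(* There is an infinite computable graph $G=(V,E)$ such that $G$ has a computable tracing function, $G$ has no chordless 4-paths, and for every set $X\subseteq\mathbb{N}$: if there exists an index $e$ such that $W_e^X$ is infinite and $W_e^X\subseteq V^{\infty}$, then $0'\leq_T X$.
   Context: A graph is a pair $G=(V,E)$ with $V\subseteq\mathbb{N}$ and $E$ a symmetric irreflexive binary relation on $V$. An $n$-path is a sequence of distinct vertices $v_0,\dots,v_{n-1}$ with $E(v_i,v_{i+1})$ for all $i\le n-2$; it is chordless if $E(v_i,v_j)$ holds if and only if $|i-j|=1$. An infinite graph $G$ is traceable if there is a bijection $T:\mathbb{N}\to V$ (a tracing function) with $E(T(i),T(i+1))$ for all $i$. A vertex $x$ has infinite degree if there are infinitely many $y$ with $E(x,y)$; $V^{\infty}$ denotes the set of vertices of infinite degree. $W_e^X$ is the $e$-th set computably enumerable relative to $X$, and $0'$ is the halting problem. *)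

theory Defs
  imports "HOL-Library.Nat_Bijection"
begin

text \<open>
  Partial recursive functions relative to an oracle \<open>X \<subseteq> \<nat>\<close>. All programs denote unary partial
  functions on \<^typ>\<open>nat\<close>; several arguments are passed as one number by means of the Cantor
  pairing \<^const>\<open>prod_encode\<close>.
\<close>

datatype prog =
    Zero
  | Succ
  | Fst
  | Snd
  | Oracle
  | Tuple prog prog
  | Comp prog prog
  | Prec prog prog
  | Mu prog

text \<open>
  Unbounded search, defined at \<open>a\<close> only if some zero \<open>n\<close> is preceded by defined values only.
\<close>

definition minimization :: "(nat \<rightharpoonup> nat) \<Rightarrow> (nat \<rightharpoonup> nat)" where
  "minimization f a =
    (let P = (\<lambda>n. f (prod_encode (a, n)) = Some 0 \<and> (\<forall>m<n. f (prod_encode (a, m)) \<noteq> None))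
     in if \<exists>n. P n then Some (LEAST n. P n) else None)"

text \<open>
  Primitive recursion \<open>h(a,0) = f(a)\<close>, \<open>h(a,i+1) = g(a,i,h(a,i))\<close>; it is undefined as soon as one
  of the intermediate values is.
\<close>

primrec primitive_recursion ::
    "(nat \<rightharpoonup> nat) \<Rightarrow> (nat \<rightharpoonup> nat) \<Rightarrow> nat \<Rightarrow> nat \<Rightarrow> nat option" where
  "primitive_recursion f g a 0 = f a"
| "primitive_recursion f g a (Suc i) =
    Option.bind (primitive_recursion f g a i) (\<lambda>r. g (prod_encode (a, prod_encode (i, r))))"

primrec eval :: "nat set \<Rightarrow> prog \<Rightarrow> (nat \<rightharpoonup> nat)" where
  "eval X Zero = (\<lambda>n. Some 0)"
| "eval X Succ = (\<lambda>n. Some (Suc n))"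
| "eval X Fst = (\<lambda>n. Some (fst (prod_decode n)))"
| "eval X Snd = (\<lambda>n. Some (snd (prod_decode n)))"
| "eval X Oracle = (\<lambda>n. Some (if n \<in> X then 1 else 0))"
| "eval X (Tuple p q) =
    (\<lambda>n. Option.bind (eval X p n) (\<lambda>a. Option.bind (eval X q n) (\<lambda>b. Some (prod_encode (a, b)))))"
| "eval X (Comp p q) = (\<lambda>n. Option.bind (eval X q n) (eval X p))"
| "eval X (Prec p q) =
    (\<lambda>n. primitive_recursion (eval X p) (eval X q) (fst (prod_decode n)) (snd (prod_decode n)))"
| "eval X (Mu p) = minimization (eval X p)"

text \<open>
  The Goedel numbering of programs is a bijection: numbers below 5 are the atomic programs, and
  \<open>5 + 4 * m + i\<close> with \<open>i < 4\<close> is the \<open>i\<close>-th compound constructor applied to the program(s)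
  coded by \<open>m\<close>.
\<close>

lemma prod_decode_le:
  "fst (prod_decode m) \<le> m" "snd (prod_decode m) \<le> m"
  using le_prod_encode_1[of "fst (prod_decode m)" "snd (prod_decode m)"]
    le_prod_encode_2[of "snd (prod_decode m)" "fst (prod_decode m)"]
  by simp_all

function prog_of :: "nat \<Rightarrow> prog" where
  "prog_of n =
    (if n = 0 then Zero else if n = 1 then Succ else if n = 2 then Fst else if n = 3 then Snd
     else if n = 4 then Oracle
     else let m = (n - 5) div 4; i = (n - 5) mod 4; l = fst (prod_decode m); r = snd (prod_decode m)
       in if i = 0 then Tuple (prog_of l) (prog_of r)
          else if i = 1 then Comp (prog_of l) (prog_of r)
          else if i = 2 then Prec (prog_of l) (prog_of r)
          else Mu (prog_of m))"
  by auto
termination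
proof (relation "measure id", goal_cases)
qed (auto intro: le_less_trans[OF prod_decode_le(1)] le_less_trans[OF prod_decode_le(2)])

declare prog_of.simps [simp del]

primrec number_of :: "prog \<Rightarrow> nat" where
  "number_of Zero = 0"
| "number_of Succ = 1"
| "number_of Fst = 2"
| "number_of Snd = 3"
| "number_of Oracle = 4"
| "number_of (Tuple p q) = 5 + 4 * prod_encode (number_of p, number_of q)"
| "number_of (Comp p q) = 6 + 4 * prod_encode (number_of p, number_of q)"
| "number_of (Prec p q) = 7 + 4 * prod_encode (number_of p, number_of q)"
| "number_of (Mu p) = 8 + 4 * number_of p"

lemma prog_of_number_of: "prog_of (number_of p) = p"
proof -
  have dm: "(4 * m + 1) div 4 = m" "(4 * m + 2) div 4 = m" "(4 * m + 3) div 4 = m"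
    "(4 * m + 1) mod 4 = 1" "(4 * m + 2) mod 4 = 2" "(4 * m + 3) mod 4 = 3" for m :: nat
    by presburger+
  show ?thesis
    by (induction p; subst prog_of.simps) (auto simp: Let_def dm dm[simplified])
qed

lemma number_of_prog_of: "number_of (prog_of n) = n"
proof (induction n rule: less_induct)
  case (less n)
  show ?case
  proof (cases "n < 5")
    case True
    then have "n = 0 \<or> n = 1 \<or> n = 2 \<or> n = 3 \<or> n = 4" by linarith
    then show ?thesis by (auto simp: prog_of.simps)
  next
    case False
    define m i where "m = (n - 5) div 4" and "i = (n - 5) mod 4"
    have n: "n = 5 + 4 * m + i" and i: "i = 0 \<or> i = 1 \<or> i = 2 \<or> i = 3"
      using False unfolding m_def i_def by presburger+
    have "m < n" using n by simp
    then have "number_of (prog_of m) = m"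
      "number_of (prog_of (fst (prod_decode m))) = fst (prod_decode m)"
      "number_of (prog_of (snd (prod_decode m))) = snd (prod_decode m)"
      using less.IH prod_decode_le[of m] le_less_trans by blast+
    moreover have "prog_of n =
      (if i = 0 then Tuple (prog_of (fst (prod_decode m))) (prog_of (snd (prod_decode m)))
       else if i = 1 then Comp (prog_of (fst (prod_decode m))) (prog_of (snd (prod_decode m)))
       else if i = 2 then Prec (prog_of (fst (prod_decode m))) (prog_of (snd (prod_decode m)))
       else Mu (prog_of m))"
      using False unfolding m_def i_def by (subst prog_of.simps) (simp add: Let_def)
    ultimately show ?thesis using i n by auto
  qed
qed

lemma bij_prog_of: "bij prog_of"
  by (rule o_bij[of number_of]) (auto simp: fun_eq_iff prog_of_number_of number_of_prog_of)

definition phi :: "nat \<Rightarrow> nat set \<Rightarrow> (nat \<rightharpoonup> nat)" where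
  "phi e X = eval X (prog_of e)"

definition W :: "nat \<Rightarrow> nat set \<Rightarrow> nat set" where
  "W e X = dom (phi e X)"

definition halting_problem :: "nat set" where
  "halting_problem = {e. e \<in> dom (phi e {})}"

definition computable_in :: "nat set \<Rightarrow> (nat \<Rightarrow> nat) \<Rightarrow> bool" where
  "computable_in X f \<longleftrightarrow> (\<exists>e. \<forall>n. phi e X n = Some (f n))"

definition turing_reducible :: "nat set \<Rightarrow> nat set \<Rightarrow> bool"  (infix \<open>\<le>\<^sub>T\<close> 50) where
  "A \<le>\<^sub>T X \<longleftrightarrow> computable_in X (\<lambda>n. if n \<in> A then 1 else 0)"

abbreviation computable :: "(nat \<Rightarrow> nat) \<Rightarrow> bool" where
  "computable f \<equiv> computable_in {} f"

abbreviation computable_set :: "nat set \<Rightarrow> bool" where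
  "computable_set A \<equiv> A \<le>\<^sub>T {}"

definition graph :: "nat set \<Rightarrow> nat rel \<Rightarrow> bool" where
  "graph V E \<longleftrightarrow> E \<subseteq> V \<times> V \<and> sym E \<and> irrefl E"

definition computable_graph :: "nat set \<Rightarrow> nat rel \<Rightarrow> bool" where
  "computable_graph V E \<longleftrightarrow> graph V E \<and> computable_set V \<and> computable_set (prod_encode ` E)"

definition path :: "nat set \<Rightarrow> nat rel \<Rightarrow> nat \<Rightarrow> nat list \<Rightarrow> bool" where
  "path V E n v \<longleftrightarrow> length v = n \<and> set v \<subseteq> V \<and> distinct v \<and>
    (\<forall>i. i + 1 < n \<longrightarrow> (v ! i, v ! (i + 1)) \<in> E)"

definition chordless_path :: "nat set \<Rightarrow> nat rel \<Rightarrow> nat \<Rightarrow> nat list \<Rightarrow> bool" where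
  "chordless_path V E n v \<longleftrightarrow> path V E n v \<and>
    (\<forall>i<n. \<forall>j<n. (v ! i, v ! j) \<in> E \<longleftrightarrow> \<bar>int i - int j\<bar> = 1)"

definition tracing_function :: "nat set \<Rightarrow> nat rel \<Rightarrow> (nat \<Rightarrow> nat) \<Rightarrow> bool" where
  "tracing_function V E T \<longleftrightarrow> bij_betw T UNIV V \<and> (\<forall>i. (T i, T (i + 1)) \<in> E)"

definition infinite_degree_vertices :: "nat set \<Rightarrow> nat rel \<Rightarrow> nat set" where
  "infinite_degree_vertices V E = {x \<in> V. infinite {y. (x, y) \<in> E}}"

end

theory Submission
  imports Defs
begin

text \<open>
  A stage \<open>s = \<langle>e, t\<rangle>\<close> gets the label \<open>e\<close> if program \<open>e\<close> first halts on input \<open>e\<close> after exactly \<open>t\<close>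
  steps, and the label \<open>s\<close> otherwise; so every label is taken finitely often. Join two stages if
  the smaller of their labels is a lower bound for all labels between them. Consecutive stages are
  joined, and the relation is tree-like, which excludes chordless paths on four vertices. A stage
  \<open>m\<close> of infinite degree is a true stage: no later label is smaller. Hence every \<open>k\<close> below the label
  of \<open>m\<close> that halts has done so at some stage before \<open>m\<close>, and an enumeration of infinitely many true
  stages, whose labels are unbounded, decides the halting problem.
\<close>

section \<open>Closure properties of relative computability\<close>

abbreviation pfst :: "nat \<Rightarrow> nat" where "pfst n \<equiv> fst (prod_decode n)"
abbreviation psnd :: "nat \<Rightarrow> nat" where "psnd n \<equiv> snd (prod_decode n)"

definition decidable_in :: "nat set \<Rightarrow> (nat \<Rightarrow> bool) \<Rightarrow> bool" where
  "decidable_in X P \<longleftrightarrow> computable_in X (\<lambda>n. if P n then 1 else 0)"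

lemma turing_reducible_iff: "A \<le>\<^sub>T X \<longleftrightarrow> decidable_in X (\<lambda>n. n \<in> A)"
  by (simp add: turing_reducible_def decidable_in_def)

lemma computable_in_iff: "computable_in X f \<longleftrightarrow> (\<exists>p. \<forall>n. eval X p n = Some (f n))"
  unfolding computable_in_def phi_def by (metis prog_of_number_of)

lemma computable_const: "computable_in X (\<lambda>n. c)"
proof -
  have "\<exists>p. \<forall>n. eval X p n = Some c"
  proof (induction c)
    case 0
    show ?case by (rule exI[of _ Zero]) simp
  next
    case (Suc c)
    then obtain p where "\<forall>n. eval X p n = Some c" by blast
    then show ?case by (intro exI[of _ "Comp Succ p"]) simp
  qed
  then show ?thesis by (simp add: computable_in_iff)
qed

text \<open>The atomic programs do not include the identity; since Cantor pairing is a bijection,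
  decoding and re-encoding yields it.\<close>

lemma computable_id: "computable_in X (\<lambda>n. n)"
  unfolding computable_in_iff by (rule exI[of _ "Tuple Fst Snd"]) simp

lemma computable_compose:
  assumes "computable_in X g" "computable_in X f"
  shows "computable_in X (\<lambda>n. g (f n))"
proof -
  obtain p q where "\<forall>n. eval X p n = Some (g n)" "\<forall>n. eval X q n = Some (f n)"
    using assms unfolding computable_in_iff by blast
  then show ?thesis unfolding computable_in_iff by (intro exI[of _ "Comp p q"]) simp
qed

lemma decidable_compose:
  assumes "decidable_in X P" "computable_in X f"
  shows "decidable_in X (\<lambda>n. P (f n))"
  using computable_compose[OF assms[unfolded decidable_in_def]] by (simp add: decidable_in_def)

lemma computable_Suc: "computable_in X f \<Longrightarrow> computable_in X (\<lambda>n. Suc (f n))"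
  by (rule computable_compose[of X Suc]) (auto simp: computable_in_iff intro: exI[of _ Succ])

lemma computable_pfst: "computable_in X f \<Longrightarrow> computable_in X (\<lambda>n. pfst (f n))"
  by (rule computable_compose[of X "\<lambda>n. pfst n"]) (auto simp: computable_in_iff intro: exI[of _ Fst])

lemma computable_psnd: "computable_in X f \<Longrightarrow> computable_in X (\<lambda>n. psnd (f n))"
  by (rule computable_compose[of X "\<lambda>n. psnd n"]) (auto simp: computable_in_iff intro: exI[of _ Snd])

lemma computable_pair:
  assumes "computable_in X f" "computable_in X g"
  shows "computable_in X (\<lambda>n. prod_encode (f n, g n))"
proof -
  obtain p q where "\<forall>n. eval X p n = Some (f n)" "\<forall>n. eval X q n = Some (g n)"
    using assms unfolding computable_in_iff by blast
  then show ?thesis unfolding computable_in_iff by (intro exI[of _ "Tuple p q"]) simp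
qed

lemma decidable_oracle: "decidable_in X (\<lambda>n. n \<in> X)"
  unfolding decidable_in_def computable_in_iff by (rule exI[of _ Oracle]) simp

text \<open>The source of the conditionals, arithmetic and bounded quantifiers below, which are
  obtained by suitable choices of \<open>f\<close>, \<open>g\<close> and \<open>h\<close>. The
  program \<open>Prec p q\<close> is fed with the pair of \<open>n\<close> and
  \<open>h n\<close>.\<close>

lemma computable_rec_nat:
  assumes "computable_in X f" "computable_in X g" "computable_in X h"
  shows "computable_in X
    (\<lambda>n. rec_nat (f n) (\<lambda>i r. g (prod_encode (n, prod_encode (i, r)))) (h n))"
proof -
  obtain p q s where pqs: "\<forall>n. eval X p n = Some (f n)" "\<forall>n. eval X q n = Some (g n)"
    "\<forall>n. eval X s n = Some (h n)"
    using assms unfolding computable_in_iff by blast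
  have "primitive_recursion (eval X p) (eval X q) n i =
      Some (rec_nat (f n) (\<lambda>i r. g (prod_encode (n, prod_encode (i, r)))) i)" for n i
    by (induction i) (simp_all add: pqs)
  with pqs show ?thesis
    unfolding computable_in_iff
    by (intro exI[of _ "Comp (Prec p q) (Tuple (Tuple Fst Snd) s)"]) simp
qed

lemmas computable_basic =
  computable_const computable_id computable_Suc computable_pfst computable_psnd computable_pair

lemma computable_if:
  assumes "decidable_in X P" "computable_in X f" "computable_in X g"
  shows "computable_in X (\<lambda>n. if P n then f n else g n)"
proof -
  have f: "computable_in X (\<lambda>n. f (pfst n))"
    by (rule computable_compose[OF assms(2)]) (intro computable_basic)
  \<comment> \<open>A recursion of length 0 or 1: the base value is the else-branch, and a single
    round overwrites it with \<open>f n\<close>.\<close>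
  have "(\<lambda>n. if P n then f n else g n) = (\<lambda>n. rec_nat (g n)
      (\<lambda>i r. f (pfst (prod_encode (n, prod_encode (i, r))))) (if P n then 1 else 0))"
    by auto
  then show ?thesis
    using computable_rec_nat[OF assms(3) f assms(1)[unfolded decidable_in_def]] by simp
qed

lemma computable_add:
  assumes "computable_in X f" "computable_in X g"
  shows "computable_in X (\<lambda>n. f n + g n)"
proof -
  have "rec_nat a (\<lambda>i. Suc) b = a + b" for a b :: nat
    by (induction b) simp_all
  moreover have "computable_in X (\<lambda>n. Suc (psnd (psnd n)))"
    by (intro computable_basic)
  from computable_rec_nat[OF assms(1) this assms(2)]
  have "computable_in X (\<lambda>n. rec_nat (f n) (\<lambda>i. Suc) (g n))" by simp
  ultimately show ?thesis by simp
qed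

lemma computable_diff:
  assumes "computable_in X f" "computable_in X g"
  shows "computable_in X (\<lambda>n. f n - g n)"
proof -
  have pred: "computable_in X (\<lambda>n. n - 1)"
  proof -
    \<comment> \<open>The last round returns its own index, which is the predecessor; truncated
      subtraction then iterates this.\<close>
    have "rec_nat 0 (\<lambda>i r. i) n = n - 1" for n :: nat
      by (cases n) simp_all
    moreover have "computable_in X (\<lambda>n. pfst (psnd n))"
      by (intro computable_basic)
    from computable_rec_nat[OF computable_const[of X 0] this computable_id]
    have "computable_in X (\<lambda>n. rec_nat 0 (\<lambda>i r. i) n)" by simp
    ultimately show ?thesis by simp
  qed
  have "rec_nat a (\<lambda>i r. r - 1) b = a - b" for a b :: nat
    by (induction b) simp_all
  moreover have "computable_in X (\<lambda>n. psnd (psnd n) - 1)"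
    by (rule computable_compose[OF pred]) (intro computable_basic)
  from computable_rec_nat[OF assms(1) this assms(2)]
  have "computable_in X (\<lambda>n. rec_nat (f n) (\<lambda>i r. r - 1) (g n))" by simp
  ultimately show ?thesis by simp
qed

section \<open>Decidable predicates\<close>

lemma decidable_eq_0:
  assumes "computable_in X f"
  shows "decidable_in X (\<lambda>n. f n = 0)"
proof -
  have "rec_nat 1 (\<lambda>i r. 0) n = (if n = 0 then 1 else (0::nat))" for n :: nat
    by (cases n) simp_all
  with computable_rec_nat[OF computable_const[of X 1] computable_const[of X 0] assms]
  show ?thesis by (simp add: decidable_in_def del: One_nat_def)
qed

lemma decidable_not:
  assumes "decidable_in X P"
  shows "decidable_in X (\<lambda>n. \<not> P n)"
proof -
  have "computable_in X (\<lambda>n. if P n then 0 else 1)"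
    by (intro computable_if assms computable_const)
  moreover have "(\<lambda>n. if P n then 0 else 1) = (\<lambda>n. if \<not> P n then 1 else (0::nat))"
    by auto
  ultimately show ?thesis by (simp only: decidable_in_def)
qed

lemma decidable_conj:
  assumes "decidable_in X P" "decidable_in X Q"
  shows "decidable_in X (\<lambda>n. P n \<and> Q n)"
proof -
  have "computable_in X (\<lambda>n. if P n then if Q n then 1 else 0 else 0)"
    by (intro computable_if assms computable_const)
  moreover have "(\<lambda>n. if P n then if Q n then 1 else 0 else 0) =
      (\<lambda>n. if P n \<and> Q n then 1 else (0::nat))"
    by auto
  ultimately show ?thesis by (simp only: decidable_in_def)
qed

lemma decidable_disj:
  assumes "decidable_in X P" "decidable_in X Q"
  shows "decidable_in X (\<lambda>n. P n \<or> Q n)"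
  using decidable_not[OF decidable_conj[OF assms[THEN decidable_not]]] by simp

lemma decidable_imp:
  assumes "decidable_in X P" "decidable_in X Q"
  shows "decidable_in X (\<lambda>n. P n \<longrightarrow> Q n)"
  unfolding imp_conv_disj by (intro decidable_disj decidable_not assms)

lemma decidable_le:
  assumes "computable_in X f" "computable_in X g"
  shows "decidable_in X (\<lambda>n. f n \<le> g n)"
  using decidable_eq_0[OF computable_diff[OF assms]] by simp

lemma decidable_less:
  assumes "computable_in X f" "computable_in X g"
  shows "decidable_in X (\<lambda>n. f n < g n)"
  using decidable_not[OF decidable_le[OF assms(2,1)]] by (simp add: not_le)

lemma decidable_eq:
  assumes "computable_in X f" "computable_in X g"
  shows "decidable_in X (\<lambda>n. f n = g n)"
  using decidable_conj[OF decidable_le[OF assms] decidable_le[OF assms(2,1)]]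
  by (simp add: eq_iff)

section \<open>Bounded quantifiers, unbounded search and division\<close>

lemma decidable_ball_less:
  assumes "decidable_in X (\<lambda>n. P (pfst n) (psnd n))" "computable_in X h"
  shows "decidable_in X (\<lambda>n. \<forall>u<h n. P n u)"
proof -
  \<comment> \<open>The accumulator, the innermost component, holds the truth value of the
    conjunction so far; one failure sets it to 0 for good.\<close>
  let ?g = "\<lambda>z. if P (pfst z) (pfst (psnd z)) then psnd (psnd z) else 0"
  have "decidable_in X (\<lambda>n. P (pfst (prod_encode (pfst n, pfst (psnd n))))
      (psnd (prod_encode (pfst n, pfst (psnd n)))))"
    by (rule decidable_compose[OF assms(1)]) (intro computable_basic)
  then have g: "computable_in X ?g"
    by (intro computable_if computable_basic) simp
  have "rec_nat 1 (\<lambda>i r. if P n i then r else 0) b = (if \<forall>u<b. P n u then 1 else (0::nat))" for n b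
    by (induction b) (auto simp: less_Suc_eq)
  with computable_rec_nat[OF computable_const[of X 1] g assms(2)] show ?thesis
    by (simp add: decidable_in_def del: One_nat_def cong: if_cong)
qed

lemma decidable_bex_less:
  assumes "decidable_in X (\<lambda>n. P (pfst n) (psnd n))" "computable_in X h"
  shows "decidable_in X (\<lambda>n. \<exists>u<h n. P n u)"
  using decidable_not[OF decidable_ball_less[where P = "\<lambda>n u. \<not> P n u", OF decidable_not assms(2)]]
    assms(1) by simp

text \<open>\<open>Mu\<close> searches for a zero, hence the negated characteristic function. This
  function is total, so the definedness clause of \<open>minimization\<close> holds, and
  \<open>ex\<close> makes every search end.\<close>

lemma computable_Least:
  assumes dec: "decidable_in X (\<lambda>n. P (pfst n) (psnd n))" and ex: "\<And>n. \<exists>m. P n m"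
  shows "computable_in X (\<lambda>n. LEAST m. P n m)"
proof -
  obtain p where p: "\<And>n. eval X p n = Some (if \<not> P (pfst n) (psnd n) then 1 else 0)"
    using decidable_not[OF dec] unfolding decidable_in_def computable_in_iff by blast
  have "eval X (Mu p) n = Some (LEAST m. P n m)" for n
    using ex[of n] by (auto simp: minimization_def p)
  then show ?thesis unfolding computable_in_iff by blast
qed

lemma computable_mod:
  assumes "computable_in X f" "k > 0"
  shows "computable_in X (\<lambda>n. f n mod k)"
proof -
  \<comment> \<open>A counter that wraps around at \<open>k\<close>; the quotient is computed
    afterwards by counting the wraps.\<close>
  have "rec_nat 0 (\<lambda>i r. if Suc r = k then 0 else Suc r) n = n mod k" for n
    using \<open>k > 0\<close> by (induction n) (auto simp: mod_Suc)
  moreover have "computable_in X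
      (\<lambda>n. if Suc (psnd (psnd n)) = k then 0 else Suc (psnd (psnd n)))"
    by (intro computable_if decidable_eq computable_basic)
  from computable_rec_nat[OF computable_const[of X 0] this assms(1)]
  have "computable_in X (\<lambda>n. rec_nat 0 (\<lambda>i r. if Suc r = k then 0 else Suc r) (f n))"
    by (simp cong: if_cong)
  ultimately show ?thesis by simp
qed

lemma computable_div:
  assumes "computable_in X f" "k > 0"
  shows "computable_in X (\<lambda>n. f n div k)"
proof -
  have "rec_nat 0 (\<lambda>i r. if Suc i mod k = 0 then Suc r else r) n = n div k" for n
    by (induction n) (auto simp: div_Suc)
  moreover have "computable_in X
      (\<lambda>n. if Suc (pfst (psnd n)) mod k = 0 then Suc (psnd (psnd n)) else psnd (psnd n))"
    by (intro computable_if decidable_eq computable_mod computable_basic assms)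
  from computable_rec_nat[OF computable_const[of X 0] this assms(1)]
  have "computable_in X (\<lambda>n. rec_nat 0 (\<lambda>i r. if Suc i mod k = 0 then Suc r else r) (f n))"
    by (simp cong: if_cong)
  ultimately show ?thesis by simp
qed

lemmas computable_intros =
  computable_basic computable_if computable_add computable_diff computable_mod computable_div

lemmas decidable_intros =
  decidable_not decidable_conj decidable_disj decidable_imp decidable_le decidable_less decidable_eq

lemma computable_funpow:
  assumes "computable_in X F" "computable_in X f" "computable_in X h"
  shows "computable_in X (\<lambda>n. (F ^^ h n) (f n))"
proof -
  have "rec_nat a (\<lambda>i. F) t = (F ^^ t) a" for a t
    by (induction t) simp_all
  moreover have "computable_in X (\<lambda>n. F (psnd (psnd n)))"
    by (rule computable_compose[OF assms(1)]) (intro computable_basic)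
  from computable_rec_nat[OF assms(2) this assms(3)]
  have "computable_in X (\<lambda>n. rec_nat (f n) (\<lambda>i. F) (h n))" by simp
  ultimately show ?thesis by simp
qed

section \<open>A stack machine for programs\<close>

text \<open>
  A configuration holds a mode, a value and a stack. Mode \<open>0\<close> returns the value to the stack;
  mode \<open>Suc e\<close> runs the program with number \<open>e\<close> on the value. Stacks are \<open>0\<close> or a pushed frame,
  which consists of a tag and data.
\<close>

abbreviation cfg :: "nat \<Rightarrow> nat \<Rightarrow> nat \<Rightarrow> nat" where
  "cfg m x k \<equiv> prod_encode (m, prod_encode (x, k))"

definition run_cfg :: "nat \<Rightarrow> nat \<Rightarrow> nat \<Rightarrow> nat" where
  "run_cfg e x k = cfg (Suc e) x k"

abbreviation push :: "nat \<Rightarrow> nat \<Rightarrow> nat \<Rightarrow> nat" where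
  "push tag d k \<equiv> Suc (prod_encode (prod_encode (tag, d), k))"

text \<open>The tag tells what awaits the value. Tags 0 and 1: the first and second component of a
  \<open>Tuple\<close>, with data the second program and its input, or the first value. Tag 2: the
  outer program of a \<open>Comp\<close>. Tag 3: the step program of a \<open>Prec\<close> with
  parameter and index. Tag 4: the body of a \<open>Mu\<close> with argument and current
  candidate.\<close>

definition return_step :: "nat \<Rightarrow> nat \<Rightarrow> nat" where
  "return_step v k =
    (let tag = pfst (pfst (k - 1)); d = psnd (pfst (k - 1)); k' = psnd (k - 1)
     in if tag = 0 then run_cfg (pfst d) (psnd d) (push 1 v k')
        else if tag = 1 then cfg 0 (prod_encode (d, v)) k'
        else if tag = 2 then run_cfg d v k'
        else if tag = 3 then
          run_cfg (pfst d) (prod_encode (pfst (psnd d), prod_encode (psnd (psnd d), v))) k'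
        else if v = 0 then cfg 0 (psnd (psnd d)) k'
        else let y = prod_encode (pfst (psnd d), Suc (psnd (psnd d)))
          in run_cfg (pfst d) y (push 4 (prod_encode (pfst d, y)) k'))"

text \<open>Only the outermost constructor of the program number is decoded, as in
  \<open>prog_of\<close>, and pending work goes to the stack. This makes a step a finite case
  distinction, hence computable.\<close>

definition run_step :: "nat set \<Rightarrow> nat \<Rightarrow> nat \<Rightarrow> nat \<Rightarrow> nat" where
  "run_step A e x k =
    (if e = 0 then cfg 0 0 k
     else if e = 1 then cfg 0 (Suc x) k
     else if e = 2 then cfg 0 (pfst x) k
     else if e = 3 then cfg 0 (psnd x) k
     else if e = 4 then cfg 0 (if x \<in> A then 1 else 0) k
     else let m = (e - 5) div 4; i = (e - 5) mod 4; l = pfst m; r = psnd m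
       in if i = 0 then run_cfg l x (push 0 (prod_encode (r, x)) k)
          else if i = 1 then run_cfg r x (push 2 l k)
          else if i = 2 then
            (if psnd x = 0 then run_cfg l (pfst x) k
             else let y = prod_encode (pfst x, psnd x - 1)
               in run_cfg e y (push 3 (prod_encode (r, y)) k))
          else run_cfg m (prod_encode (x, 0)) (push 4 (prod_encode (m, prod_encode (x, 0))) k))"

definition step :: "nat set \<Rightarrow> nat \<Rightarrow> nat" where
  "step A c = (if pfst c = 0 then return_step (pfst (psnd c)) (psnd (psnd c))
    else run_step A (pfst c - 1) (pfst (psnd c)) (psnd (psnd c)))"

definition halted :: "nat \<Rightarrow> bool" where
  "halted c \<longleftrightarrow> pfst c = 0 \<and> psnd (psnd c) = 0"

text \<open>Refers to time \<open>t\<close> exactly: a halted configuration is not a fixed point of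
  \<open>step\<close>, which continues from it as if the empty stack held a frame.\<close>

definition halts_in :: "nat set \<Rightarrow> nat \<Rightarrow> nat \<Rightarrow> bool" where
  "halts_in A t c \<longleftrightarrow> halted ((step A ^^ t) c)"

text \<open>The oracle \<open>A\<close> of the simulated machine is separate from \<open>X\<close>:
  the reduction simulates both \<open>A = X\<close>, to enumerate a set, and \<open>A = {}\<close>,
  to compute labels.\<close>

lemma computable_step:
  assumes "decidable_in X (\<lambda>n. n \<in> A)"
  shows "computable_in X (step A)"
proof -
  have "computable_in X (\<lambda>c. if pfst c = 0 then return_step (pfst (psnd c)) (psnd (psnd c))
    else run_step A (pfst c - 1) (pfst (psnd c)) (psnd (psnd c)))"
    unfolding return_step_def run_step_def run_cfg_def Let_def
    by (intro computable_intros decidable_intros decidable_compose[OF assms]) simp_all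
  then show ?thesis by (simp add: step_def[abs_def])
qed

lemma computable_run_cfg:
  assumes "computable_in X f" "computable_in X g" "computable_in X h"
  shows "computable_in X (\<lambda>n. run_cfg (f n) (g n) (h n))"
  unfolding run_cfg_def by (intro computable_basic assms)

lemma decidable_halts_in:
  assumes "decidable_in X (\<lambda>n. n \<in> A)" "computable_in X f" "computable_in X h"
  shows "decidable_in X (\<lambda>n. halts_in A (h n) (f n))"
  unfolding halts_in_def halted_def
  by (intro decidable_intros computable_intros computable_funpow computable_step assms)

section \<open>Single transitions of the machine\<close>

lemma step_return [simp]:
  "step A (cfg 0 v (push 0 (prod_encode (r, x)) k)) = run_cfg r x (push (Suc 0) v k)"
  "step A (cfg 0 v (push (Suc 0) d k)) = cfg 0 (prod_encode (d, v)) k"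
  "step A (cfg 0 v (push 2 d k)) = run_cfg d v k"
  "step A (cfg 0 v (push 3 (prod_encode (r, prod_encode (a, i))) k)) =
    run_cfg r (prod_encode (a, prod_encode (i, v))) k"
  "step A (cfg 0 0 (push 4 (prod_encode (r, prod_encode (a, i))) k)) = cfg 0 i k"
  "step A (cfg 0 (Suc v) (push 4 (prod_encode (r, prod_encode (a, i))) k)) =
    run_cfg r (prod_encode (a, Suc i)) (push 4 (prod_encode (r, prod_encode (a, Suc i))) k)"
  by (simp_all add: step_def return_step_def run_cfg_def Let_def)

lemma step_run [simp]:
  "step A (run_cfg 0 x k) = cfg 0 0 k"
  "step A (run_cfg (Suc 0) x k) = cfg 0 (Suc x) k"
  "step A (run_cfg 2 x k) = cfg 0 (pfst x) k"
  "step A (run_cfg 3 x k) = cfg 0 (psnd x) k"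
  "step A (run_cfg 4 x k) = cfg 0 (if x \<in> A then 1 else 0) k"
  "step A (run_cfg (5 + 4 * prod_encode (l, r)) x k) =
    run_cfg l x (push 0 (prod_encode (r, x)) k)"
  "step A (run_cfg (6 + 4 * prod_encode (l, r)) x k) = run_cfg r x (push 2 l k)"
  "step A (run_cfg (7 + 4 * prod_encode (l, r)) (prod_encode (a, 0)) k) = run_cfg l a k"
  "step A (run_cfg (7 + 4 * prod_encode (l, r)) (prod_encode (a, Suc i)) k) =
    run_cfg (7 + 4 * prod_encode (l, r)) (prod_encode (a, i))
      (push 3 (prod_encode (r, prod_encode (a, i))) k)"
  "step A (run_cfg (8 + 4 * m) x k) =
    run_cfg m (prod_encode (x, 0)) (push 4 (prod_encode (m, prod_encode (x, 0))) k)"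
proof -
  \<comment> \<open>The offsets 5, 6, 7, 8 in \<open>number_of\<close> are \<open>5 + i\<close> for
    \<open>i < 4\<close>, so one computation of quotient and remainder serves all four compound
    constructors.\<close>
  have compound: "run_step A (5 + 4 * m + i) x k =
      (if i = 0 then run_cfg (pfst m) x (push 0 (prod_encode (psnd m, x)) k)
       else if i = 1 then run_cfg (psnd m) x (push 2 (pfst m) k)
       else if i = 2 then
         (if psnd x = 0 then run_cfg (pfst m) (pfst x) k
          else let y = prod_encode (pfst x, psnd x - 1)
            in run_cfg (5 + 4 * m + i) y (push 3 (prod_encode (psnd m, y)) k))
       else run_cfg m (prod_encode (x, 0)) (push 4 (prod_encode (m, prod_encode (x, 0))) k))"
    if "i < 4" for m i x
  proof -
    have "(5 + 4 * m + i - 5) div 4 = m" "(5 + 4 * m + i - 5) mod 4 = i"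
      using that by simp_all
    then show ?thesis by (simp add: run_step_def Let_def)
  qed
  have run: "step A (run_cfg e x k) = run_step A e x k" for e x
    by (simp add: step_def run_cfg_def)
  show "step A (run_cfg 0 x k) = cfg 0 0 k"
    "step A (run_cfg (Suc 0) x k) = cfg 0 (Suc x) k"
    "step A (run_cfg 2 x k) = cfg 0 (pfst x) k"
    "step A (run_cfg 3 x k) = cfg 0 (psnd x) k"
    "step A (run_cfg 4 x k) = cfg 0 (if x \<in> A then 1 else 0) k"
    by (simp_all add: run run_step_def)
  show "step A (run_cfg (5 + 4 * prod_encode (l, r)) x k) =
      run_cfg l x (push 0 (prod_encode (r, x)) k)"
    using compound[of 0 "prod_encode (l, r)" x] by (simp add: run)
  show "step A (run_cfg (6 + 4 * prod_encode (l, r)) x k) = run_cfg r x (push 2 l k)"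
    using compound[of 1 "prod_encode (l, r)" x] by (simp add: run)
  show "step A (run_cfg (7 + 4 * prod_encode (l, r)) (prod_encode (a, 0)) k) = run_cfg l a k"
    using compound[of 2 "prod_encode (l, r)" "prod_encode (a, 0)"] by (simp add: run)
  show "step A (run_cfg (7 + 4 * prod_encode (l, r)) (prod_encode (a, Suc i)) k) =
      run_cfg (7 + 4 * prod_encode (l, r)) (prod_encode (a, i))
        (push 3 (prod_encode (r, prod_encode (a, i))) k)"
    using compound[of 2 "prod_encode (l, r)" "prod_encode (a, Suc i)"] by (simp add: run Let_def)
  show "step A (run_cfg (8 + 4 * m) x k) =
      run_cfg m (prod_encode (x, 0)) (push 4 (prod_encode (m, prod_encode (x, 0))) k)"
    using compound[of 3 m x] by (simp add: run)
qed

text \<open>Peels one step off a halting run; the remaining time drops, which is how time bounds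
  become strict below.\<close>

lemma halts_in_stepD:
  assumes "halts_in A t c" "\<not> halted c"
  obtains s where "t = Suc s" "halts_in A s (step A c)"
  using assms by (cases t) (auto simp: halts_in_def funpow_swap1)

lemma not_halted [simp]: "\<not> halted (run_cfg e x k)" "\<not> halted (cfg 0 v (push tag d k))"
  by (simp_all add: halted_def run_cfg_def)

section \<open>Agreement of the machine with the evaluation of programs\<close>

definition reaches :: "nat set \<Rightarrow> nat \<Rightarrow> nat \<Rightarrow> bool" where
  "reaches A c d \<longleftrightarrow> (\<exists>t. (step A ^^ t) c = d)"

lemma reaches_refl: "reaches A c c"
  unfolding reaches_def by (rule exI[of _ 0]) simp

lemma reaches_trans: "reaches A b c \<Longrightarrow> reaches A c d \<Longrightarrow> reaches A b d"
  unfolding reaches_def by (metis funpow_add comp_apply)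

lemma reaches_stepI: "reaches A (step A c) d \<Longrightarrow> reaches A c d"
  unfolding reaches_def by (metis funpow_Suc_right comp_apply)

text \<open>A smaller candidate with value 0 would itself be the result, so smaller candidates have
  positive values. This is the form in which the machine's search loop sees them.\<close>

lemma minimization_eq_Some_iff:
  "minimization f a = Some n \<longleftrightarrow>
    f (prod_encode (a, n)) = Some 0 \<and> (\<forall>m<n. \<exists>w. f (prod_encode (a, m)) = Some (Suc w))"
  (is "_ \<longleftrightarrow> ?R n")
proof -
  define P where "P n \<longleftrightarrow>
    f (prod_encode (a, n)) = Some 0 \<and> (\<forall>m<n. f (prod_encode (a, m)) \<noteq> None)" for n
  have eq: "minimization f a = (if \<exists>n. P n then Some (LEAST n. P n) else None)"
    unfolding minimization_def P_def Let_def by (rule refl)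
  show ?thesis
  proof
    assume "minimization f a = Some n"
    then have "\<exists>n. P n" and n: "n = (LEAST n. P n)"
      unfolding eq by (auto split: if_splits)
    then have "P n" by (auto intro: LeastI_ex)
    have "\<exists>w. f (prod_encode (a, m)) = Some (Suc w)" if "m < n" for m
    proof -
      obtain w where w: "f (prod_encode (a, m)) = Some w"
        using \<open>P n\<close> \<open>m < n\<close> by (auto simp: P_def)
      have "\<not> P m" using \<open>m < n\<close> n not_less_Least by blast
      moreover have "\<forall>j<m. f (prod_encode (a, j)) \<noteq> None"
        using \<open>P n\<close> \<open>m < n\<close> unfolding P_def by (meson less_trans)
      ultimately have "w \<noteq> 0" using w by (simp add: P_def)
      with w show ?thesis by (cases w) simp_all
    qed
    then show "?R n" using \<open>P n\<close> by (simp add: P_def)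
  next
    assume R: "?R n"
    then have "P n" unfolding P_def by fastforce
    moreover have "(LEAST n. P n) = n"
    proof (rule Least_equality)
      show "P n" by fact
    next
      fix m assume "P m"
      show "n \<le> m"
      proof (rule ccontr)
        assume "\<not> n \<le> m"
        then obtain w where "f (prod_encode (a, m)) = Some (Suc w)" using R not_le by blast
        with \<open>P m\<close> show False by (simp add: P_def)
      qed
    qed
    ultimately show "minimization f a = Some n" unfolding eq by auto
  qed
qed

text \<open>Completeness of the machine. The stack stays arbitrary in the induction on programs,
  because subprograms run on top of pushed frames.\<close>

lemma reaches_return:
  "eval A p x = Some v \<Longrightarrow> reaches A (run_cfg (number_of p) x k) (cfg 0 v k)"
proof (induction p arbitrary: x v k)
  case (Tuple p q)
  then obtain a b where ab: "eval A p x = Some a" "eval A q x = Some b" "v = prod_encode (a, b)"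
    by (auto simp: bind_eq_Some_conv)
  let ?c1 = "run_cfg (number_of (Tuple p q)) x k"
  let ?c2 = "cfg 0 a (push 0 (prod_encode (number_of q, x)) k)"
  let ?c3 = "cfg 0 b (push (Suc 0) a k)"
  have "reaches A (step A ?c1) ?c2" "reaches A (step A ?c2) ?c3" "reaches A (step A ?c3) (cfg 0 v k)"
    by (simp_all add: Tuple.IH ab reaches_refl)
  then show ?case by (blast intro: reaches_stepI reaches_trans)
next
  case (Comp p q)
  then obtain a where a: "eval A q x = Some a" "eval A p a = Some v"
    by (auto simp: bind_eq_Some_conv)
  let ?c1 = "run_cfg (number_of (Comp p q)) x k" and ?c2 = "cfg 0 a (push 2 (number_of p) k)"
  have "reaches A (step A ?c1) ?c2" "reaches A (step A ?c2) (cfg 0 v k)"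
    by (simp_all add: Comp.IH a)
  then show ?case by (blast intro: reaches_stepI reaches_trans)
next
  case (Prec p q)
  obtain a i where x: "x = prod_encode (a, i)" by (metis prod_decode_inverse surj_pair)
  \<comment> \<open>The machine first descends to counter 0 and pushes a frame per level, so the
    inner induction also generalises the stack.\<close>
  have "primitive_recursion (eval A p) (eval A q) a i = Some v \<Longrightarrow>
    reaches A (run_cfg (number_of (Prec p q)) (prod_encode (a, i)) k) (cfg 0 v k)" for k v
  proof (induction i arbitrary: k v)
    case 0
    then have "reaches A (step A (run_cfg (number_of (Prec p q)) (prod_encode (a, 0)) k)) (cfg 0 v k)"
      by (simp add: Prec.IH(1))
    then show ?case by (rule reaches_stepI)
  next
    case (Suc i)
    then obtain r where r: "primitive_recursion (eval A p) (eval A q) a i = Some r"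
      "eval A q (prod_encode (a, prod_encode (i, r))) = Some v"
      by (auto simp: bind_eq_Some_conv)
    let ?c1 = "run_cfg (number_of (Prec p q)) (prod_encode (a, Suc i)) k"
    let ?c2 = "cfg 0 r (push 3 (prod_encode (number_of q, prod_encode (a, i))) k)"
    have "reaches A (step A ?c1) ?c2" using Suc.IH[OF r(1)] by simp
    moreover have "reaches A (step A ?c2) (cfg 0 v k)" by (simp add: Prec.IH(2) r(2))
    ultimately show ?case by (blast intro: reaches_stepI reaches_trans)
  qed
  with Prec.prems x show ?case by simp
next
  case (Mu p)
  let ?c = "\<lambda>j. run_cfg (number_of p) (prod_encode (x, j))
    (push 4 (prod_encode (number_of p, prod_encode (x, j))) k)"
  have v: "eval A p (prod_encode (x, v)) = Some 0"
    "\<And>m. m < v \<Longrightarrow> \<exists>w. eval A p (prod_encode (x, m)) = Some (Suc w)"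
    using Mu.prems by (auto simp: minimization_eq_Some_iff)
  \<comment> \<open>\<open>?c j\<close> is the loop state testing candidate \<open>j\<close>; the
    induction goes down from the successful candidate \<open>v\<close> to 0.\<close>
  have "reaches A (?c 0) (cfg 0 v k)"
  proof (rule inc_induct[of 0 v "\<lambda>j. reaches A (?c j) (cfg 0 v k)"])
    show "reaches A (?c v) (cfg 0 v k)"
      by (rule reaches_trans[OF Mu.IH[OF v(1)]], rule reaches_stepI) (simp add: reaches_refl)
  next
    fix j assume "j < v" and IH: "reaches A (?c (Suc j)) (cfg 0 v k)"
    then obtain w where "eval A p (prod_encode (x, j)) = Some (Suc w)" using v(2) by blast
    from Mu.IH[OF this] have "reaches A (?c j)
        (cfg 0 (Suc w) (push 4 (prod_encode (number_of p, prod_encode (x, j))) k))" .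
    moreover have "reaches A (step A
        (cfg 0 (Suc w) (push 4 (prod_encode (number_of p, prod_encode (x, j))) k))) (cfg 0 v k)"
      using IH by simp
    ultimately show "reaches A (?c j) (cfg 0 v k)" by (blast intro: reaches_stepI reaches_trans)
  qed simp
  then have "reaches A (step A (run_cfg (number_of (Mu p)) x k)) (cfg 0 v k)" by simp
  then show ?case by (rule reaches_stepI)
qed (rule reaches_stepI, force simp: reaches_refl)+

text \<open>Soundness of the machine: a halting run must first return a value to the stack
  \<open>k\<close> it started with. The strict bound \<open>s < t\<close> supports the induction on
  time for \<open>Mu\<close>.\<close>

lemma halts_in_return:
  "halts_in A t (run_cfg (number_of p) x k) \<Longrightarrow>
    \<exists>v s. s < t \<and> eval A p x = Some v \<and> halts_in A s (cfg 0 v k)"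
proof (induction p arbitrary: t x k)
  case (Tuple p q)
  from Tuple.prems obtain t1 where t1: "t = Suc t1"
    "halts_in A t1 (run_cfg (number_of p) x (push 0 (prod_encode (number_of q, x)) k))"
    by (rule halts_in_stepD) simp_all
  from Tuple.IH(1)[OF t1(2)] obtain a t2 where a: "t2 < t1" "eval A p x = Some a"
    "halts_in A t2 (cfg 0 a (push 0 (prod_encode (number_of q, x)) k))" by blast
  from a(3) obtain t3 where t3: "t2 = Suc t3"
    "halts_in A t3 (run_cfg (number_of q) x (push (Suc 0) a k))"
    by (rule halts_in_stepD) simp_all
  from Tuple.IH(2)[OF t3(2)] obtain b t4 where b: "t4 < t3" "eval A q x = Some b"
    "halts_in A t4 (cfg 0 b (push (Suc 0) a k))" by blast
  from b(3) obtain t5 where t5: "t4 = Suc t5" "halts_in A t5 (cfg 0 (prod_encode (a, b)) k)"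
    by (rule halts_in_stepD) simp_all
  show ?case
    by (rule exI[of _ "prod_encode (a, b)"], rule exI[of _ t5]) (use t1 a t3 b t5 in simp)
next
  case (Comp p q)
  from Comp.prems obtain t1 where t1: "t = Suc t1"
    "halts_in A t1 (run_cfg (number_of q) x (push 2 (number_of p) k))"
    by (rule halts_in_stepD) simp_all
  from Comp.IH(2)[OF t1(2)] obtain a t2 where a: "t2 < t1" "eval A q x = Some a"
    "halts_in A t2 (cfg 0 a (push 2 (number_of p) k))" by blast
  from a(3) obtain t3 where t3: "t2 = Suc t3" "halts_in A t3 (run_cfg (number_of p) a k)"
    by (rule halts_in_stepD) simp_all
  from Comp.IH(1)[OF t3(2)] obtain b t4 where b: "t4 < t3" "eval A p a = Some b"
    "halts_in A t4 (cfg 0 b k)" by blast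
  show ?case by (rule exI[of _ b], rule exI[of _ t4]) (use t1 a t3 b in simp)
next
  case (Prec p q)
  obtain a i where x: "x = prod_encode (a, i)" by (metis prod_decode_inverse surj_pair)
  have "halts_in A t (run_cfg (number_of (Prec p q)) (prod_encode (a, i)) k) \<Longrightarrow>
    \<exists>v s. s < t \<and> primitive_recursion (eval A p) (eval A q) a i = Some v \<and>
      halts_in A s (cfg 0 v k)" for t k
  proof (induction i arbitrary: t k)
    case 0
    then obtain t1 where t1: "t = Suc t1" "halts_in A t1 (run_cfg (number_of p) a k)"
      by (rule halts_in_stepD) simp_all
    from Prec.IH(1)[OF t1(2)] obtain v s where
      "s < t1" "eval A p a = Some v" "halts_in A s (cfg 0 v k)" by blast
    then show ?case using t1(1) by (intro exI[of _ v] exI[of _ s]) simp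
  next
    case (Suc i)
    from Suc.prems obtain t1 where t1: "t = Suc t1"
      "halts_in A t1 (run_cfg (number_of (Prec p q)) (prod_encode (a, i))
        (push 3 (prod_encode (number_of q, prod_encode (a, i))) k))"
      by (rule halts_in_stepD) simp_all
    from Suc.IH[OF t1(2)] obtain r t2 where r: "t2 < t1"
      "primitive_recursion (eval A p) (eval A q) a i = Some r"
      "halts_in A t2 (cfg 0 r (push 3 (prod_encode (number_of q, prod_encode (a, i))) k))"
      by blast
    from r(3) obtain t3 where t3: "t2 = Suc t3"
      "halts_in A t3 (run_cfg (number_of q) (prod_encode (a, prod_encode (i, r))) k)"
      by (rule halts_in_stepD) simp_all
    from Prec.IH(2)[OF t3(2)] obtain b t4 where b: "t4 < t3"
      "eval A q (prod_encode (a, prod_encode (i, r))) = Some b" "halts_in A t4 (cfg 0 b k)"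
      by blast
    show ?case by (rule exI[of _ b], rule exI[of _ t4]) (use t1 r t3 b in simp)
  qed
  from this[of t k] Prec.prems show ?case by (simp add: x)
next
  case (Mu p)
  let ?c = "\<lambda>j. run_cfg (number_of p) (prod_encode (x, j))
    (push 4 (prod_encode (number_of p, prod_encode (x, j))) k)"
  \<comment> \<open>The number of rounds is not known in advance, so the induction is on the
    remaining time; the invariant is that all candidates below \<open>n\<close> gave positive
    values.\<close>
  have loop: "\<lbrakk>halts_in A t (?c n); \<forall>m<n. \<exists>w. eval A p (prod_encode (x, m)) = Some (Suc w)\<rbrakk> \<Longrightarrow>
    \<exists>v s. s < t \<and> minimization (eval A p) x = Some v \<and> halts_in A s (cfg 0 v k)" for t n
  proof (induction t arbitrary: n rule: less_induct)
    case (less t)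
    from Mu.IH[OF less.prems(1)] obtain v t1 where v: "t1 < t"
      "eval A p (prod_encode (x, n)) = Some v"
      "halts_in A t1 (cfg 0 v (push 4 (prod_encode (number_of p, prod_encode (x, n))) k))"
      by blast
    from v(3) obtain t2 where t2: "t1 = Suc t2" "halts_in A t2 (step A
      (cfg 0 v (push 4 (prod_encode (number_of p, prod_encode (x, n))) k)))"
      by (rule halts_in_stepD) simp_all
    show ?case
    proof (cases v)
      case 0
      then have "minimization (eval A p) x = Some n"
        using v(2) less.prems(2) by (simp add: minimization_eq_Some_iff)
      moreover have "halts_in A t2 (cfg 0 n k)" using t2(2) 0 by simp
      ultimately show ?thesis using t2(1) v(1) Suc_lessD by blast
    next
      case (Suc w)
      then have "halts_in A t2 (?c (Suc n))" using t2(2) by simp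
      moreover have "\<forall>m<Suc n. \<exists>w. eval A p (prod_encode (x, m)) = Some (Suc w)"
        using less.prems(2) v(2) Suc by (auto simp: less_Suc_eq)
      ultimately obtain u s where "s < t2" "minimization (eval A p) x = Some u"
        "halts_in A s (cfg 0 u k)"
        using less.IH[of t2 "Suc n"] t2(1) v(1) by auto
      then show ?thesis using t2(1) v(1) by (intro exI[of _ u] exI[of _ s]) simp
    qed
  qed
  from Mu.prems obtain t1 where "t = Suc t1" "halts_in A t1 (?c 0)"
    by (rule halts_in_stepD) simp_all
  with loop[of t1 0] show ?case by (auto intro: less_SucI)
qed (erule halts_in_stepD; force)+

text \<open>Completeness and soundness with the empty stack 0, where returning a value means being
  halted.\<close>

lemma mem_W_iff: "x \<in> W e A \<longleftrightarrow> (\<exists>t. halts_in A t (run_cfg e x 0))"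
proof
  assume "x \<in> W e A"
  then obtain v where "eval A (prog_of e) x = Some v" by (auto simp: W_def phi_def)
  then have "reaches A (run_cfg e x 0) (cfg 0 v 0)"
    using reaches_return[of A "prog_of e" x v 0] by (simp add: number_of_prog_of)
  then show "\<exists>t. halts_in A t (run_cfg e x 0)"
    by (metis fst_conv halted_def halts_in_def prod_encode_inverse reaches_def snd_conv)
next
  assume "\<exists>t. halts_in A t (run_cfg e x 0)"
  then show "x \<in> W e A"
    using halts_in_return[of A _ "prog_of e" x 0]
    by (auto simp: number_of_prog_of W_def phi_def)
qed

section \<open>The graph\<close>

text \<open>For injective \<open>a\<close>, this joins two indices iff one is an ancestor of the other in the Cartesian tree of \<open>a\<close>.\<close>

definition cartesian_edges :: "(nat \<Rightarrow> nat) \<Rightarrow> nat rel" where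
  "cartesian_edges a = {(m, n). m \<noteq> n \<and>
    (\<forall>u. m \<le> u \<and> u \<le> n \<or> n \<le> u \<and> u \<le> m \<longrightarrow> a m \<le> a u \<or> a n \<le> a u)}"

lemma graph_cartesian_edges: "graph UNIV (cartesian_edges a)"
  by (auto simp: graph_def sym_def irrefl_def cartesian_edges_def)

text \<open>The only indices between neighbours are the two endpoints. This makes the identity a
  tracing function.\<close>

lemma cartesian_edges_Suc: "(i, Suc i) \<in> cartesian_edges a"
  by (auto simp: cartesian_edges_def le_Suc_eq)

text \<open>The stretches from \<open>w\<close> to \<open>x\<close> and from \<open>x\<close> to
  \<open>y\<close> cover the one from \<open>w\<close> to \<open>y\<close>. On each, labels are
  bounded below by an endpoint label, and these are all at least \<open>a w\<close>.\<close>

lemma cartesian_edges_trans: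
  assumes "(w, x) \<in> cartesian_edges a" "(x, y) \<in> cartesian_edges a"
    and "a w \<le> a x" "a w \<le> a y" "w \<noteq> y"
  shows "(w, y) \<in> cartesian_edges a"
proof -
  have "a w \<le> a u" if u: "w \<le> u \<and> u \<le> y \<or> y \<le> u \<and> u \<le> w" for u
  proof -
    have "(w \<le> u \<and> u \<le> x \<or> x \<le> u \<and> u \<le> w) \<or> (x \<le> u \<and> u \<le> y \<or> y \<le> u \<and> u \<le> x)"
      using u by linarith
    then show ?thesis
      using assms unfolding cartesian_edges_def by (auto dest: order_trans)
  qed
  then show ?thesis using \<open>w \<noteq> y\<close> by (auto simp: cartesian_edges_def)
qed

text \<open>A vertex of the path with least label would be joined to a vertex at distance two.\<close>

lemma no_chordless_path_cartesian_edges: "\<not> chordless_path V (cartesian_edges a) 4 v"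
proof
  assume p: "chordless_path V (cartesian_edges a) 4 v"
  let ?E = "cartesian_edges a"
  have len: "length v = 4" and dist: "distinct v"
    and E: "\<And>i j. i < 4 \<Longrightarrow> j < 4 \<Longrightarrow> (v ! i, v ! j) \<in> ?E \<longleftrightarrow> \<bar>int i - int j\<bar> = 1"
    using p by (auto simp: chordless_path_def path_def)
  \<comment> \<open>If the first of three consecutive path vertices, read in either direction, had
    the least label, transitivity would create a chord to the third.\<close>
  have no: "\<not> (a (v ! i) \<le> a (v ! j) \<and> a (v ! i) \<le> a (v ! k))"
    if "i < 4" "j < 4" "k < 4" "\<bar>int i - int j\<bar> = 1" "\<bar>int j - int k\<bar> = 1" "i \<noteq> k" for i j k
  proof
    assume "a (v ! i) \<le> a (v ! j) \<and> a (v ! i) \<le> a (v ! k)"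
    moreover have "v ! i \<noteq> v ! k" using that len dist by (simp add: nth_eq_iff_index_eq)
    ultimately have "(v ! i, v ! k) \<in> ?E"
      using cartesian_edges_trans[of "v ! i" "v ! j" a "v ! k"] E that by blast
    then show False using E that by auto
  qed
  \<comment> \<open>Each of the four positions is an end of three consecutive ones, so none can
    carry the minimum. The middle of a 3-path is no such end, whence the length 4.\<close>
  have "\<not> (a (v ! 0) \<le> a (v ! 1) \<and> a (v ! 0) \<le> a (v ! 2))"
    "\<not> (a (v ! 1) \<le> a (v ! 2) \<and> a (v ! 1) \<le> a (v ! 3))"
    "\<not> (a (v ! 2) \<le> a (v ! 1) \<and> a (v ! 2) \<le> a (v ! 0))"
    "\<not> (a (v ! 3) \<le> a (v ! 2) \<and> a (v ! 3) \<le> a (v ! 1))"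
    using no[of 0 1 2] no[of 1 2 3] no[of 2 1 0] no[of 3 2 1] by simp_all
  then show False by linarith
qed

lemma infinite_degree_cartesian_edges:
  assumes fin: "\<And>b. finite {n. a n \<le> b}"
    and m: "m \<in> infinite_degree_vertices V (cartesian_edges a)" and "m \<le> u"
  shows "a m \<le> a u"
proof (rule ccontr)
  assume "\<not> a m \<le> a u"
  \<comment> \<open>A neighbour \<open>n > u\<close> has \<open>u\<close> in between, and
    \<open>a m \<le> a u\<close> fails, so \<open>a n \<le> a u < a m\<close>; only finitely many
    \<open>n\<close> have such small labels.\<close>
  then have "{n. (m, n) \<in> cartesian_edges a} \<subseteq> {..u} \<union> {n. a n \<le> a m}"
    using \<open>m \<le> u\<close> by (force simp: cartesian_edges_def)
  then have "finite {n. (m, n) \<in> cartesian_edges a}"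
    using fin finite_subset by blast
  then show False using m by (simp add: infinite_degree_vertices_def)
qed

lemma computable_graph_cartesian_edges:
  assumes "computable a"
  shows "computable_graph UNIV (cartesian_edges a)"
proof -
  let ?m = "\<lambda>x. pfst x" and ?n = "\<lambda>x. psnd x"
  \<comment> \<open>Every index between the endpoints is at most their sum, which turns the
    quantifier into a bounded one.\<close>
  have "x \<in> prod_encode ` cartesian_edges a \<longleftrightarrow> ?m x \<noteq> ?n x \<and> (\<forall>u<Suc (?m x + ?n x).
      ?m x \<le> u \<and> u \<le> ?n x \<or> ?n x \<le> u \<and> u \<le> ?m x \<longrightarrow> a (?m x) \<le> a u \<or> a (?n x) \<le> a u)" for x
  proof -
    have "x \<in> prod_encode ` cartesian_edges a \<longleftrightarrow> (?m x, ?n x) \<in> cartesian_edges a"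
      by (metis image_iff prod.collapse prod_decode_inverse prod_encode_inverse)
    moreover have "u < Suc (m + n)" if "m \<le> u \<and> u \<le> n \<or> n \<le> u \<and> u \<le> m" for u m n :: nat
      using that by linarith
    ultimately show ?thesis unfolding cartesian_edges_def by blast
  qed
  moreover have "decidable_in {} (\<lambda>x. ?m x \<noteq> ?n x \<and> (\<forall>u<Suc (?m x + ?n x).
      ?m x \<le> u \<and> u \<le> ?n x \<or> ?n x \<le> u \<and> u \<le> ?m x \<longrightarrow> a (?m x) \<le> a u \<or> a (?n x) \<le> a u))"
    by (intro decidable_ball_less decidable_intros computable_intros computable_compose[OF assms])
  moreover have "computable_set UNIV"
    by (simp add: turing_reducible_def computable_const)
  ultimately show ?thesis
    by (simp add: computable_graph_def graph_cartesian_edges turing_reducible_iff)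
qed

section \<open>The labelling\<close>

text \<open>Since one run can be halted at several times, minimality of the time is what leaves a
  single stage per halting program.\<close>

definition first_halt :: "nat \<Rightarrow> bool" where
  "first_halt s \<longleftrightarrow> halts_in {} (psnd s) (run_cfg (pfst s) (pfst s) 0) \<and>
    (\<forall>t<psnd s. \<not> halts_in {} t (run_cfg (pfst s) (pfst s) 0))"

definition label :: "nat \<Rightarrow> nat" where
  "label s = (if first_halt s then pfst s else s)"

lemma halting_problem_iff: "e \<in> halting_problem \<longleftrightarrow> (\<exists>s. pfst s = e \<and> first_halt s)"
proof -
  let ?Q = "\<lambda>t. halts_in {} t (run_cfg e e 0)"
  have "e \<in> halting_problem \<longleftrightarrow> (\<exists>t. ?Q t)"
    using mem_W_iff[of e e "{}"] by (simp add: halting_problem_def W_def)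
  also have "\<dots> \<longleftrightarrow> (\<exists>t. ?Q t \<and> (\<forall>t'<t. \<not> ?Q t'))"
    using exists_least_iff[of ?Q] .
  also have "\<dots> \<longleftrightarrow> (\<exists>s. pfst s = e \<and> first_halt s)"
    (is "?L \<longleftrightarrow> ?R")
  proof
    assume ?L
    then obtain t where "?Q t" "\<forall>t'<t. \<not> ?Q t'" by blast
    then show ?R by (intro exI[of _ "prod_encode (e, t)"]) (simp add: first_halt_def)
  qed (auto simp: first_halt_def)
  finally show ?thesis .
qed

lemma first_halt_unique:
  assumes "first_halt s" "first_halt s'" "pfst s = pfst s'"
  shows "s = s'"
proof -
  have "psnd s = psnd s'"
    using assms unfolding first_halt_def by (cases "psnd s" "psnd s'" rule: linorder_cases) auto
  with \<open>pfst s = pfst s'\<close> show ?thesis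
    by (metis prod_decode_eq prod_eqI)
qed

text \<open>A stage labelled by itself is at most \<open>b\<close>; the others are first halting
  stages of programs up to \<open>b\<close>, at most one for each program.\<close>

lemma finite_label_le: "finite {s. label s \<le> b}"
proof -
  have "inj_on pfst {s. first_halt s}"
    by (auto intro!: inj_onI first_halt_unique)
  then have "finite (pfst -` {..b} \<inter> {s. first_halt s})"
    by (intro finite_vimage_IntI) simp_all
  moreover have "{s. label s \<le> b} \<subseteq> {..b} \<union> (pfst -` {..b} \<inter> {s. first_halt s})"
    by (auto simp: label_def split: if_splits)
  ultimately show ?thesis using finite_subset by blast
qed

lemma decidable_first_halt: "computable_in X f \<Longrightarrow> decidable_in X (\<lambda>n. first_halt (f n))"
proof (rule decidable_compose)
  have "decidable_in X (\<lambda>n. n \<in> {})"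
    by (simp add: decidable_in_def computable_const)
  then show "decidable_in X first_halt"
    unfolding first_halt_def[abs_def]
    by (intro decidable_ball_less decidable_intros decidable_halts_in computable_run_cfg
      computable_intros)
qed

lemma computable_label: "computable_in X f \<Longrightarrow> computable_in X (\<lambda>n. label (f n))"
  unfolding label_def by (intro computable_intros decidable_first_halt)

section \<open>Deciding the halting problem from infinitely many true stages\<close>

lemma halting_problem_reducible:
  assumes inf: "infinite (W e X)" and sub: "\<And>m u. m \<in> W e X \<Longrightarrow> m \<le> u \<Longrightarrow> label m \<le> label u"
  shows "halting_problem \<le>\<^sub>T X"
proof -
  \<comment> \<open>The number \<open>z\<close> codes a stage and a running time, so a single search
    over \<open>z\<close> dovetails the enumeration of \<open>W e X\<close>.\<close>
  define Q where "Q k z \<longleftrightarrow> halts_in X (psnd z) (run_cfg e (pfst z) 0) \<and> k < label (pfst z)" for k z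
  define m where "m k = pfst (LEAST z. Q k z)" for k
  have ex: "\<exists>z. Q k z" for k
  proof -
    \<comment> \<open>Only finitely many stages have label at most \<open>k\<close>, and
      \<open>W e X\<close> is infinite.\<close>
    obtain x where "x \<in> W e X" "\<not> label x \<le> k"
      using inf finite_subset[OF _ finite_label_le[of k]] by blast
    then obtain t where "halts_in X t (run_cfg e x 0)" "k < label x"
      by (auto simp: mem_W_iff)
    then show ?thesis by (intro exI[of _ "prod_encode (x, t)"]) (simp add: Q_def)
  qed
  have m: "m k \<in> W e X" "k < label (m k)" for k
    using LeastI_ex[OF ex, of k] by (auto simp: m_def Q_def mem_W_iff)
  have "k \<in> halting_problem \<longleftrightarrow> (\<exists>s<m k. pfst s = k \<and> first_halt s)" for k
  proof -
    \<comment> \<open>A first halting stage of \<open>k\<close> from \<open>m k\<close> on would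
      have label \<open>k\<close>, below the label of the true stage \<open>m k\<close>.\<close>
    have "s < m k" if "pfst s = k" "first_halt s" for s
    proof (rule ccontr)
      assume "\<not> s < m k"
      then have "label (m k) \<le> label s" using sub[OF m(1)] by simp
      also have "label s = k" using that by (simp add: label_def)
      finally show False using m(2)[of k] by simp
    qed
    then show ?thesis unfolding halting_problem_iff by blast
  qed
  moreover have "computable_in X m"
    unfolding m_def[abs_def] Q_def
    by (intro computable_basic computable_Least ex[unfolded Q_def] decidable_intros
      decidable_halts_in decidable_oracle computable_run_cfg computable_label)
  then have "decidable_in X (\<lambda>k. \<exists>s<m k. pfst s = k \<and> first_halt s)"
    by (intro decidable_bex_less decidable_intros decidable_first_halt computable_basic)
  ultimately show ?thesis by (simp add: turing_reducible_iff)
qed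

theorem theorem2p1:
  shows "\<exists>(V :: nat set) (E :: nat rel).
    computable_graph V E \<and> infinite V \<and>
    (\<exists>T. tracing_function V E T \<and> computable T) \<and>
    (\<nexists>v. chordless_path V E 4 v) \<and>
    (\<forall>X :: nat set.
      (\<exists>e. infinite (W e X) \<and> W e X \<subseteq> infinite_degree_vertices V E) \<longrightarrow> halting_problem \<le>\<^sub>T X)"
proof (intro exI conjI allI impI)
  show "computable_graph UNIV (cartesian_edges label)"
    by (intro computable_graph_cartesian_edges computable_label computable_id)
  show "infinite (UNIV :: nat set)" by simp
  show "tracing_function UNIV (cartesian_edges label) (\<lambda>i. i)"
    by (simp add: tracing_function_def cartesian_edges_Suc bij_betw_def)
  show "computable (\<lambda>i. i)" by (rule computable_id)
  show "\<nexists>v. chordless_path UNIV (cartesian_edges label) 4 v"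
    using no_chordless_path_cartesian_edges by blast
next
  fix X
  assume "\<exists>e. infinite (W e X) \<and> W e X \<subseteq> infinite_degree_vertices UNIV (cartesian_edges label)"
  then show "halting_problem \<le>\<^sub>T X"
    using halting_problem_reducible infinite_degree_cartesian_edges[OF finite_label_le] by blast
qed

end
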